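(* Let $f:\mathbb{C}[x,y]\to\mathbb{C}[x,y]$ be a $\mathbb{C}$-algebra endomorphism, and put $p:=f(x)$, $q:=f(y)$. Assume that $\operatorname{Jac}(p,q)\in\mathbb{C}^*$. Let $u\in\mathbb{C}[p,q,x]\setminus\{0\}$ and $v\in\mathbb{C}[p,q]\setminus\{0\}$ be such that $y=u/v$ in $\mathbb{C}(x,y)$. If the group of invertible elements of the ring $\mathbb{C}[p,q,x][1/v]\subset\mathbb{C}(x,y)$ is contained in $\mathbb{C}(p,q)\setminus\{0\}$, then $f$ is an automorphism of $\mathbb{C}[x,y]$.
   Context: $\operatorname{Jac}(p,q)=\frac{\partial p}{\partial x}\frac{\partial q}{\partial y}-\frac{\partial p}{\partial y}\frac{\partial q}{\partial x}$ is the Jacobian determinant. $\mathbb{C}[p,q]$ and $\mathbb{C}[p,q,x]$ denote the $\mathbb{C}$-subalgebras of $\mathbb{C}[x,y]$ generated by the listed elements, $\mathbb{C}(p,q)$ denotes the subfield of $\mathbb{C}(x,y)$ generated over $\mathbb{C}$ by $p,q$, and $\mathbb{C}[p,q,x][1/v]$ is the subring of $\mathbb{C}(x,y)$ generated by $\mathbb{C}[p,q,x]$ and $1/v$. Elements $u,v$ with $y=u/v$ as described always exist under the Jacobian hypothesis. *)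

theory Defs
  imports "HOL-Computational_Algebra.Computational_Algebra"
begin

text \<open>
  The ring \<open>\<complex>[x,y]\<close> is represented as \<open>\<complex>[x][y]\<close>: the outer polynomial variable is \<open>y\<close>, and
  \<open>x\<close> is the variable of the coefficient ring. The field \<open>\<complex>(x,y)\<close> is its field of fractions,
  with embedding \<open>to_fract\<close>.
\<close>

type_synonym cpoly2 = "complex poly poly"
type_synonym crat2 = "cpoly2 fract"

definition const2 :: "complex \<Rightarrow> cpoly2" where
  "const2 c = [:[:c:]:]"

definition varX :: cpoly2 where
  "varX = [:[:0, 1:]:]"

definition varY :: cpoly2 where
  "varY = [:0, 1:]"

text \<open>Since \<open>x\<close> lives in the coefficients, \<open>\<partial>/\<partial>x\<close> differentiates coefficientwise.\<close>

definition partial_x :: "cpoly2 \<Rightarrow> cpoly2" where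
  "partial_x p = map_poly pderiv p"

definition partial_y :: "cpoly2 \<Rightarrow> cpoly2" where
  "partial_y p = pderiv p"

definition Jac :: "cpoly2 \<Rightarrow> cpoly2 \<Rightarrow> cpoly2" where
  "Jac p q = partial_x p * partial_y q - partial_y p * partial_x q"

definition alg_endo :: "(cpoly2 \<Rightarrow> cpoly2) \<Rightarrow> bool" where
  "alg_endo f \<longleftrightarrow>
     (\<forall>a b. f (a + b) = f a + f b) \<and>
     (\<forall>a b. f (a * b) = f a * f b) \<and>
     (\<forall>c. f (const2 c) = const2 c)"

definition alg_auto :: "(cpoly2 \<Rightarrow> cpoly2) \<Rightarrow> bool" where
  "alg_auto f \<longleftrightarrow> alg_endo f \<and> bij f"

definition is_subring :: "'a::comm_ring_1 set \<Rightarrow> bool" where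
  "is_subring R \<longleftrightarrow> 1 \<in> R \<and> (\<forall>a\<in>R. \<forall>b\<in>R. a - b \<in> R \<and> a * b \<in> R)"

definition is_subfield :: "'a::field set \<Rightarrow> bool" where
  "is_subfield K \<longleftrightarrow> is_subring K \<and> (\<forall>a\<in>K. a \<noteq> 0 \<longrightarrow> inverse a \<in> K)"

text \<open>The \<open>\<complex>\<close>-subalgebra \<open>\<complex>[S]\<close> of \<open>\<complex>[x,y]\<close>: the smallest subring containing \<open>\<complex>\<close> and \<open>S\<close>.\<close>

definition alg_gen :: "cpoly2 set \<Rightarrow> cpoly2 set" where
  "alg_gen S = is_subring hull (range const2 \<union> S)"

text \<open>The subfield \<open>\<complex>(S)\<close> of \<open>\<complex>(x,y)\<close>, for \<open>S\<close> a set of polynomials.\<close>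

definition field_gen :: "cpoly2 set \<Rightarrow> crat2 set" where
  "field_gen S = is_subfield hull (to_fract ` (range const2 \<union> S))"

text \<open>The subring \<open>R[1/v]\<close> of \<open>\<complex>(x,y)\<close>, for a subset \<open>R\<close> of \<open>\<complex>[x,y]\<close>.\<close>

definition adjoin_inverse :: "cpoly2 set \<Rightarrow> cpoly2 \<Rightarrow> crat2 set" where
  "adjoin_inverse R v = is_subring hull (to_fract ` R \<union> {1 / to_fract v})"

definition unit_group :: "'a::comm_ring_1 set \<Rightarrow> 'a set" where
  "unit_group R = {a \<in> R. \<exists>b\<in>R. a * b = 1}"

lemma is_subring_hull: "is_subring (is_subring hull S)"
  by (rule hull_in) (auto simp: is_subring_def)

lemma is_subfield_hull: "is_subfield (is_subfield hull S)"
  by (rule hull_in) (auto simp: is_subfield_def is_subring_def)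

end

theory Submission
  imports Defs "HOL-Computational_Algebra.Field_as_Ring"
begin

text \<open>
  Write \<open>B = \<complex>[x,y]\<close> and \<open>A = \<complex>[p,q]\<close>, the image of \<open>f\<close>. A constant nonzero Jacobian makes \<open>f\<close>
  injective: by the chain rule the kernel is stable under both partial derivatives, so a nonzero
  element of it could be differentiated down to a nonzero constant. Hence \<open>A\<close> is a polynomial
  ring, and what has to be shown is \<open>A = B\<close>.

  Since \<open>y = u/v\<close> lies in \<open>\<complex>[p,q,x][1/v]\<close>, this ring equals \<open>B[1/v]\<close>, and every divisor in \<open>B\<close> of a
  power of \<open>v\<close> is a unit of it. By Gauss's lemma the kernel of the evaluation \<open>A[T] \<rightarrow> B\<close>, \<open>T \<mapsto> x\<close>,
  is generated by one polynomial \<open>F\<close> (\<open>ev_kernel_generator\<close>). The derivative \<open>F'\<close> takes a unit of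
  \<open>B[1/v]\<close> as its value at \<open>x\<close> (\<open>ev_pderiv_generator_dvd_power\<close>). Indeed, let \<open>W \<in> A[1/v][T]\<close> be
  the polynomial \<open>U/v\<close>, where \<open>U \<in> A[T]\<close> satisfies \<open>U(x) = u\<close>. Then \<open>p(T,W) - p\<close> and \<open>q(T,W) - q\<close>
  vanish at \<open>T = x\<close>, so they are multiples \<open>\<alpha> F\<close> and \<open>\<beta> F\<close> with \<open>\<alpha>, \<beta> \<in> A[1/v][T]\<close>. Differentiating
  in \<open>T\<close> and putting \<open>T = x\<close> gives
  \<open>p\<^sub>x + p\<^sub>y W'(x) = \<alpha>(x) F'(x)\<close> and \<open>q\<^sub>x + q\<^sub>y W'(x) = \<beta>(x) F'(x)\<close>,
  and eliminating \<open>W'(x)\<close> gives \<open>Jac(p,q) = F'(x) (\<alpha>(x) q\<^sub>y - \<beta>(x) p\<^sub>y)\<close>.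

  By the hypothesis on units, \<open>F'(x)\<close> therefore lies in \<open>\<complex>(p,q)\<close>. As \<open>F'\<close> has smaller degree than
  the generator \<open>F\<close>, this forces \<open>F'\<close> to be constant in \<open>T\<close>, that is, \<open>deg F = 1\<close>, so that \<open>x \<in> \<complex>(p,q)\<close>
  (\<open>varX_in_range\<close>).

  Finally, \<open>\<complex>(p,q) \<inter> B = A\<close> (\<open>dvd_reflect\<close>): let \<open>a/d\<close> be a reduced fraction over \<open>A\<close> that lies in
  \<open>B\<close>. A prime factor of \<open>d\<close> in \<open>B\<close> divides both \<open>d\<close> and \<open>a\<close>. As these are coprime in \<open>A\<close>,
  it divides a nonzero element of \<open>\<complex>[p]\<close>, which splits into linear factors, so it divides some
  \<open>p - x\<^sub>0\<close>; similarly it divides some \<open>q - y\<^sub>0\<close>. Then it divides the Jacobian, which is a unit. So \<open>d\<close>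
  has no prime factor in \<open>B\<close> and is constant. Thus \<open>x \<in> A\<close>, then \<open>u \<in> A\<close>, and then \<open>y = u/v \<in> A\<close>.
\<close>

section \<open>Minimal-degree elements of polynomial ideals\<close>

text \<open>
  A nonzero element of minimal degree in an ideal of \<open>R[T]\<close> generates the ideal over the fraction
  field of \<open>R\<close>; by Gauss's lemma its primitive part then divides every element of the ideal over
  \<open>R\<close>. The primitive part need not lie in the ideal itself.
\<close>

lemma ideal_primitive_generator:
  fixes I :: "'a::{factorial_ring_gcd, semiring_gcd_mult_normalize} poly set"
  assumes diff: "\<And>a b. a \<in> I \<Longrightarrow> b \<in> I \<Longrightarrow> a - b \<in> I"
    and mult: "\<And>a b. a \<in> I \<Longrightarrow> b * a \<in> I"
    and nontriv: "\<exists>a\<in>I. a \<noteq> 0"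
  obtains m where "m \<in> I" "m \<noteq> 0" "\<And>g. g \<in> I \<Longrightarrow> primitive_part m dvd g"
proof -
  obtain m where m: "m \<in> I" "m \<noteq> 0"
    and min: "\<And>g. g \<in> I \<Longrightarrow> g \<noteq> 0 \<Longrightarrow> degree m \<le> degree g"
    using exists_least_lemma[of "\<lambda>n. \<exists>a\<in>I. a \<noteq> 0 \<and> degree a = n"] nontriv
      ex_has_least_nat[of "\<lambda>a. a \<in> I \<and> a \<noteq> 0" _ degree] by blast
  have "primitive_part m dvd g" if g: "g \<in> I" for g
  proof -
    define r where "r = pseudo_mod g m"
    obtain a s where a: "a \<noteq> 0" and eq: "smult a g = m * s + r"
      using pseudo_mod(1)[OF m(2)] unfolding r_def by blast
    have "r = [:a:] * g - s * m" using eq by (simp add: algebra_simps)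
    then have "r \<in> I" using diff[OF mult[OF g] mult[OF m(1)]] by metis
    moreover have "r = 0 \<or> degree r < degree m"
      using pseudo_mod(2)[OF m(2)] unfolding r_def .
    ultimately have "r = 0" using min by fastforce
    then have "primitive_part (smult a g) = primitive_part m * primitive_part s"
      using eq by (simp add: primitive_part_mult)
    then have "primitive_part m dvd smult (unit_factor a) (primitive_part g)"
      by (simp add: primitive_part_smult)
    then have "primitive_part m dvd
        smult (content g * (1 div unit_factor a)) (smult (unit_factor a) (primitive_part g))"
      by (rule dvd_smult)
    also have "\<dots> = g"
      using a by (simp add: mult.assoc)
    finally show ?thesis .
  qed
  then show ?thesis using that m by blast
qed

text \<open>
  Coprime elements of \<open>R[T]\<close> generate an ideal that contains a nonzero constant of \<open>R\<close>.
\<close>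

lemma coprime_polys_bezout:
  fixes a b :: "'a::{factorial_ring_gcd, semiring_gcd_mult_normalize} poly"
  assumes "coprime a b"
  obtains s t r where "r \<noteq> 0" "s * a + t * b = [:r:]"
proof -
  define I where "I = {g. \<exists>s t. g = s * a + t * b}"
  have ab: "a \<in> I" "b \<in> I"
    unfolding I_def by (auto intro: exI[of _ 1] exI[of _ 0])
  have "a \<noteq> 0 \<or> b \<noteq> 0" using assms by auto
  then have nontriv: "\<exists>a\<in>I. a \<noteq> 0" using ab by blast
  have diff: "g - h \<in> I" if "g \<in> I" "h \<in> I" for g h
  proof -
    from that obtain s t s' t' where "g = s * a + t * b" "h = s' * a + t' * b"
      unfolding I_def by blast
    then have "g - h = (s - s') * a + (t - t') * b" by (simp add: algebra_simps)
    then show ?thesis unfolding I_def by blast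
  qed
  have mult: "h * g \<in> I" if "g \<in> I" for g h
  proof -
    from that obtain s t where "g = s * a + t * b" unfolding I_def by blast
    then have "h * g = (h * s) * a + (h * t) * b" by (simp add: algebra_simps)
    then show ?thesis unfolding I_def by blast
  qed
  obtain m where m: "m \<in> I" "m \<noteq> 0" and gen: "\<And>g. g \<in> I \<Longrightarrow> primitive_part m dvd g"
    using ideal_primitive_generator[OF diff mult nontriv] by blast
  have "is_unit (primitive_part m)" using gen ab assms by (meson coprime_common_divisor)
  then have "degree m = 0"
    using dvd_imp_degree_le[of "primitive_part m" 1] by simp
  then obtain r where "m = [:r:]" using degree_eq_zeroE by blast
  then show ?thesis using that m unfolding I_def by auto
qed

section \<open>Calculus and algebra in two variables\<close>

lemma const2_simps [simp]:
  "const2 0 = 0" "const2 1 = 1" "const2 (a + b) = const2 a + const2 b"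
  "const2 (- a) = - const2 a" "const2 (a * b) = const2 a * const2 b"
  by (simp_all add: const2_def one_pCons)

lemma const2_eq_0_iff [simp]: "const2 a = 0 \<longleftrightarrow> a = 0"
  by (simp add: const2_def)

lemma is_unit_const2: "a \<noteq> 0 \<Longrightarrow> is_unit (const2 a)"
  by (simp add: const2_def is_unit_const_poly_iff dvd_field_iff)

lemma cpoly2_induct [case_names const varX varY add mult]:
  assumes "\<And>a. P (const2 a)" "P varX" "P varY"
    and add: "\<And>g h. P g \<Longrightarrow> P h \<Longrightarrow> P (g + h)"
    and mult: "\<And>g h. P g \<Longrightarrow> P h \<Longrightarrow> P (g * h)"
  shows "P g"
proof -
  have const: "P [:r:]" for r
  proof (induction r)
    case 0
    show ?case using assms(1)[of 0] by (simp add: const2_def)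
  next
    case (pCons a r)
    have "[:pCons a r:] = const2 a + varX * [:r:]"
      by (simp add: const2_def varX_def)
    then show ?case using assms pCons by metis
  qed
  show ?thesis
  proof (induction g)
    case 0
    show ?case using const[of 0] by simp
  next
    case (pCons r g)
    have "pCons r g = [:r:] + varY * g" by (simp add: varY_def)
    then show ?case using assms pCons const by metis
  qed
qed

lemma partial_simps [simp]:
  "partial_x (const2 a) = 0" "partial_x varX = 1" "partial_x varY = 0"
  "partial_y (const2 a) = 0" "partial_y varX = 0" "partial_y varY = 1"
  "partial_x (g + h) = partial_x g + partial_x h"
  "partial_y (g + h) = partial_y g + partial_y h"
  by (auto simp: partial_x_def partial_y_def const2_def varX_def varY_def one_pCons
      map_poly_pCons pderiv_pCons pderiv_add coeff_map_poly intro!: poly_eqI)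

lemma partial_y_mult: "partial_y (g * h) = partial_y g * h + g * partial_y h"
  by (simp add: partial_y_def pderiv_mult algebra_simps)

lemma partial_x_mult: "partial_x (g * h) = partial_x g * h + g * partial_x h"
proof (rule poly_eqI)
  fix n
  have pderiv_sum: "pderiv (sum r A) = (\<Sum>i\<in>A. pderiv (r i))" for r :: "nat \<Rightarrow> complex poly" and A
    by (induction A rule: infinite_finite_induct) (simp_all add: pderiv_add)
  have "pderiv (coeff (g * h) n) =
      (\<Sum>i\<le>n. pderiv (coeff g i) * coeff h (n - i) + coeff g i * pderiv (coeff h (n - i)))"
    unfolding coeff_mult pderiv_sum by (intro sum.cong) (simp_all add: pderiv_mult algebra_simps)
  then show "coeff (partial_x (g * h)) n = coeff (partial_x g * h + g * partial_x h) n"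
    by (simp add: partial_x_def coeff_map_poly coeff_mult sum.distrib)
qed

text \<open>
  The map \<open>g\<close> stands for a \<open>\<complex>\<close>-algebra homomorphism from \<open>\<complex>[T]\<close>; additivity is not needed. Over
  \<open>\<complex>\<close> the polynomial \<open>r\<close> splits, so a prime dividing \<open>g(r)\<close> divides the image of a linear factor.
\<close>

lemma prime_dvd_linear_factor:
  fixes g :: "complex poly \<Rightarrow> cpoly2"
  assumes const: "\<And>a. g [:a:] = const2 a" and mult: "\<And>r s. g (r * s) = g r * g s"
    and h: "prime_elem h" and "r \<noteq> 0" "h dvd g r"
  shows "\<exists>a. h dvd g [:-a, 1:]"
  using assms(4,5)
proof (induction "degree r" arbitrary: r)
  case 0
  then obtain b where b: "r = [:b:]" using degree_eq_zeroE by metis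
  then have "is_unit (g r)" using const is_unit_const2 0 by auto
  then show ?case using 0 h by (meson dvd_trans prime_elem_not_unit)
next
  case (Suc n)
  then obtain a where "poly r a = 0"
    by (metis fundamental_theorem_of_algebra constant_degree nat.distinct(1))
  then obtain s where s: "r = [:-a, 1:] * s" by (auto simp: poly_eq_0_iff_dvd)
  then have "s \<noteq> 0" using Suc by auto
  then have "degree s = n" using s Suc.hyps(2) by (simp del: mult_pCons_left add: degree_mult_eq)
  moreover have "h dvd g [:-a, 1:] \<or> h dvd g s"
    using Suc.prems(2) h unfolding s mult by (rule prime_elem_dvd_multD[rotated])
  ultimately show ?case using Suc.hyps(1) \<open>s \<noteq> 0\<close> by blast
qed

lemma Jac_dvd_of_dvd_diff_const:
  assumes "h dvd p - const2 a" "h dvd q - const2 b"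
  shows "h dvd Jac p q"
proof -
  obtain p' q' where "p = h * p' + const2 a" "q = h * q' + const2 b"
    using assms by (metis dvdE diff_add_cancel)
  then have "Jac p q = h * (partial_x h * p' * partial_y q' + partial_x p' * partial_y h * q'
      + h * partial_x p' * partial_y q' - partial_y h * p' * partial_x q'
      - partial_y p' * partial_x h * q' - h * partial_y p' * partial_x q')"
    by (simp add: Jac_def partial_x_mult partial_y_mult algebra_simps)
  then show ?thesis by simp
qed

section \<open>Generated subrings\<close>

lemma is_subring_range:
  fixes g :: "'a::comm_ring_1 \<Rightarrow> 'b::comm_ring_1"
  assumes "g e = 1" "\<And>a b. g (a - b) = g a - g b" "\<And>a b. g (a * b) = g a * g b"
  shows "is_subring (range g)"
  unfolding is_subring_def by (metis assms imageE rangeI)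

lemma is_subring_add:
  assumes "is_subring R" "a \<in> R" "b \<in> R"
  shows "a + b \<in> R"
proof -
  have "0 \<in> R" using assms unfolding is_subring_def by (metis diff_self)
  then have "a - (0 - b) \<in> R" using assms unfolding is_subring_def by blast
  then show ?thesis by simp
qed

lemma is_subring_power:
  assumes "is_subring R" "a \<in> R"
  shows "a ^ n \<in> R"
  using assms by (induction n) (auto simp: is_subring_def)

lemma alg_gen_superset: "range const2 \<union> S \<subseteq> alg_gen S"
  unfolding alg_gen_def by (rule hull_subset)

text \<open>
  If \<open>y = u/v\<close> with \<open>u \<in> \<complex>[S]\<close> and \<open>x \<in> S\<close>, then \<open>\<complex>[S][1/v]\<close> contains all of \<open>\<complex>[x,y]\<close>, so the
  divisors of powers of \<open>v\<close> become units there.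
\<close>

lemma adjoin_inverse_units:
  assumes x: "varX \<in> S" and u: "u \<in> alg_gen S" and v: "v \<noteq> 0"
    and y: "to_fract varY = to_fract u / to_fract v" and gw: "g * w = v ^ n"
  shows "to_fract g \<in> unit_group (adjoin_inverse (alg_gen S) v)"
proof -
  define R where "R = adjoin_inverse (alg_gen S) v"
  have R: "is_subring R" unfolding R_def adjoin_inverse_def by (rule is_subring_hull)
  have "to_fract ` alg_gen S \<union> {1 / to_fract v} \<subseteq> R"
    unfolding R_def adjoin_inverse_def by (rule hull_subset)
  then have gens: "\<And>h. h \<in> alg_gen S \<Longrightarrow> to_fract h \<in> R" and inv: "1 / to_fract v \<in> R" by auto
  have mult: "a * b \<in> R" if "a \<in> R" "b \<in> R" for a b
    using R that unfolding is_subring_def by blast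
  have "to_fract varY \<in> R" using mult[OF gens[OF u] inv] y by simp
  then have all: "to_fract h \<in> R" for h
    using alg_gen_superset[of S] x gens mult is_subring_add[OF R]
    by (induction h rule: cpoly2_induct) (auto simp: image_subset_iff)
  define w' where "w' = to_fract w * (1 / to_fract v) ^ n"
  have "w' \<in> R" unfolding w'_def using mult[OF all] is_subring_power[OF R inv] by blast
  have power: "to_fract (v ^ n) = to_fract v ^ n" by (induction n) simp_all
  have "to_fract g * w' = to_fract (g * w) * (1 / to_fract v) ^ n" by (simp add: w'_def)
  also have "\<dots> = 1" unfolding gw power using v by (simp add: power_one_over)
  finally show ?thesis
    using all \<open>w' \<in> R\<close> unfolding unit_group_def R_def[symmetric] by blast
qed

section \<open>Endomorphisms with invertible Jacobian\<close>

text \<open>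
  A \<open>\<complex>\<close>-algebra endomorphism of \<open>\<complex>[x,y]\<close> whose Jacobian is the nonzero constant \<open>c\<close>. An element
  \<open>g\<close> of \<open>\<complex>[x,y]\<close> serves also as a polynomial in two indeterminates, and \<open>f g\<close> is its value at
  \<open>(f x, f y)\<close>.
\<close>

locale keller_endo =
  fixes f :: "cpoly2 \<Rightarrow> cpoly2" and c :: complex
  assumes endo: "alg_endo f"
    and Jac: "Jac (f varX) (f varY) = const2 c" and c: "c \<noteq> 0"
begin

lemma f_add [simp]: "f (a + b) = f a + f b"
  and f_mult [simp]: "f (a * b) = f a * f b"
  and f_const2 [simp]: "f (const2 k) = const2 k"
  using endo by (auto simp: alg_endo_def)

lemma f_0 [simp]: "f 0 = 0" and f_1 [simp]: "f 1 = 1"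
  using f_const2[of 0] f_const2[of 1] by simp_all

lemma f_uminus [simp]: "f (- a) = - f a"
  by (metis add_eq_0_iff f_0 f_add)

lemma f_diff [simp]: "f (a - b) = f a - f b"
  by (metis f_add f_uminus diff_conv_add_uminus)

lemma f_power [simp]: "f (a ^ n) = f a ^ n"
  by (induction n) simp_all

lemma chain_rule_x:
  "partial_x (f g) = f (partial_x g) * partial_x (f varX) + f (partial_y g) * partial_x (f varY)"
  by (induction g rule: cpoly2_induct) (simp_all add: partial_x_mult partial_y_mult algebra_simps)

lemma chain_rule_y:
  "partial_y (f g) = f (partial_x g) * partial_y (f varX) + f (partial_y g) * partial_y (f varY)"
  by (induction g rule: cpoly2_induct) (simp_all add: partial_x_mult partial_y_mult algebra_simps)

lemma kernel_partials:
  assumes "f g = 0"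
  shows "f (partial_x g) = 0" "f (partial_y g) = 0"
proof -
  let ?a = "f (partial_x g)" and ?b = "f (partial_y g)"
  have eqs: "?a * partial_x (f varX) + ?b * partial_x (f varY) = 0"
    "?a * partial_y (f varX) + ?b * partial_y (f varY) = 0"
    using chain_rule_x[of g] chain_rule_y[of g] assms
    by (simp_all add: partial_x_def partial_y_def)
  have "?a * const2 c = (?a * partial_x (f varX) + ?b * partial_x (f varY)) * partial_y (f varY)
      - (?a * partial_y (f varX) + ?b * partial_y (f varY)) * partial_x (f varY)"
    unfolding Jac[symmetric] Jac_def by (simp add: algebra_simps)
  then show "?a = 0" unfolding eqs using c by simp
  have "?b * const2 c = (?a * partial_y (f varX) + ?b * partial_y (f varY)) * partial_x (f varX)
      - (?a * partial_x (f varX) + ?b * partial_x (f varY)) * partial_y (f varX)"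
    unfolding Jac[symmetric] Jac_def by (simp add: algebra_simps)
  then show "?b = 0" unfolding eqs using c by simp
qed

lemma kernel_trivial:
  assumes "f g = 0"
  shows "g = 0"
proof -
  have const: "r = 0" if "f [:r:] = 0" for r
    using that
  proof (induction "degree r" arbitrary: r rule: less_induct)
    case less
    have "f [:pderiv r:] = 0"
      using kernel_partials(1)[OF less.prems] by (simp add: partial_x_def map_poly_pCons)
    then have "degree r = 0"
      using less.hyps[of "pderiv r"] by (cases "degree r = 0") (auto simp: degree_pderiv pderiv_eq_0_iff)
    then obtain a where "r = [:a:]" using degree_eq_zeroE by blast
    then show ?case using less.prems f_const2[of a] by (simp add: const2_def)
  qed
  show ?thesis
    using assms
  proof (induction "degree g" arbitrary: g rule: less_induct)
    case less
    have "f (pderiv g) = 0"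
      using kernel_partials(2)[OF less.prems] by (simp add: partial_y_def)
    then have "degree g = 0"
      using less.hyps[of "pderiv g"] by (cases "degree g = 0") (auto simp: degree_pderiv pderiv_eq_0_iff)
    then obtain r where "g = [:r:]" using degree_eq_zeroE by blast
    then show ?case using less.prems const by simp
  qed
qed

lemma f_eq_0_iff [simp]: "f g = 0 \<longleftrightarrow> g = 0"
  using kernel_trivial by auto

lemma inj_f: "inj f"
  by (rule injI) (metis f_diff f_eq_0_iff eq_iff_diff_eq_0)

text \<open>
  Setting the first variable to the constant \<open>a\<close> changes a polynomial by a multiple of \<open>x - a\<close>; this
  is transported by \<open>f\<close>.
\<close>

lemma f_X_dvd_reduce:
  "f [:[:-a, 1:]:] dvd f g - f (map_poly (\<lambda>r. [:poly r a:]) g)"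
proof (induction g)
  case (pCons r g)
  have "[:-a, 1:] dvd r - [:poly r a:]" by (simp add: poly_eq_0_iff_dvd[symmetric])
  then obtain s where s: "r = [:-a, 1:] * s + [:poly r a:]" by (metis dvdE diff_add_cancel)
  define g' where "g' = map_poly (\<lambda>r. [:poly r a:]) g"
  have "f (pCons r g) - f (map_poly (\<lambda>r. [:poly r a:]) (pCons r g)) =
    f (pCons r g - pCons [:poly r a:] g')"
    by (simp add: map_poly_pCons g'_def del: diff_pCons)
  also have "pCons r g - pCons [:poly r a:] g' = [:[:-a, 1:]:] * [:s:] + varY * (g - g')"
    using s by (simp add: varY_def algebra_simps)
  finally have "f (pCons r g) - f (map_poly (\<lambda>r. [:poly r a:]) (pCons r g)) =
      f [:[:-a, 1:]:] * f [:s:] + f varY * (f g - f g')"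
    by (simp only: f_add f_mult f_diff)
  then show ?case using pCons.IH unfolding g'_def by (metis dvd_add dvd_mult dvd_triv_left)
qed simp

text \<open>
  Divisibility in \<open>\<complex>[x,y]\<close> between elements of \<open>\<complex>[p,q]\<close> already holds in \<open>\<complex>[p,q]\<close>; equivalently,
  \<open>\<complex>(p,q) \<inter> \<complex>[x,y] = \<complex>[p,q]\<close>.
\<close>

lemma dvd_reflect:
  assumes "f d dvd f a"
  shows "d dvd a"
proof (cases "d = 0")
  case False
  define g where "g = gcd d a"
  have "g \<noteq> 0" using False by (simp add: g_def)
  obtain d' a' where da: "d = g * d'" "a = g * a'" "coprime d' a'"
    using gcd_coprime_exists[of d a] False unfolding g_def by (metis gcd_eq_0_iff mult.commute)
  have "f d' dvd f a'" using assms \<open>g \<noteq> 0\<close> by (simp add: da)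
  have "d' \<noteq> 0" using False da by auto
  have unit: "is_unit (f d')"
  proof (rule ccontr)
    assume "\<not> is_unit (f d')"
    then obtain h where h: "h dvd f d'" "prime_elem h"
      using prime_divisor_exists[of "f d'"] \<open>d' \<noteq> 0\<close> by auto
    have ha: "h dvd f a'" using h \<open>f d' dvd f a'\<close> by auto
    obtain s t r where r: "r \<noteq> 0" and st: "s * d' + t * a' = [:r:]"
      using coprime_polys_bezout[OF da(3)] .
    have "h dvd f [:r:]" unfolding st[symmetric] using h ha by simp
    \<comment> \<open>The Bezout constant \<open>r\<close> involves the first variable only and splits over \<open>\<complex>\<close>.\<close>
    then have "\<exists>x0. h dvd f [:[:-x0, 1:]:]"
      using prime_dvd_linear_factor[of "\<lambda>r. f [:r:]" h r] h(2) r f_const2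
      by (simp add: const2_def mult.commute flip: f_mult)
    then obtain x0 where x0: "h dvd f [:[:-x0, 1:]:]" by blast
    \<comment> \<open>Putting the first variable to \<open>x0\<close> preserves divisibility by \<open>h\<close>, and by coprimality it
      cannot annihilate both \<open>d'\<close> and \<open>a'\<close>; this leaves a nonzero polynomial in the second variable.\<close>
    define red where "red = map_poly (\<lambda>r. [:poly r x0:])"
    have hred: "h dvd f (red g)" if "h dvd f g" for g
    proof -
      have "h dvd f g - f (red g)"
        using dvd_trans[OF x0 f_X_dvd_reduce] unfolding red_def .
      then show ?thesis using that by (metis dvd_diff diff_diff_eq2 add_diff_cancel_left')
    qed
    have red0: "[:[:-x0, 1:]:] dvd g" if "red g = 0" for g
    proof -
      have "[:-x0, 1:] dvd coeff g n" for n
        using arg_cong[OF that, of "\<lambda>g. coeff g n"]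
        by (simp add: red_def coeff_map_poly poly_eq_0_iff_dvd)
      then show ?thesis by (simp add: const_poly_dvd_iff)
    qed
    have "\<not> ([:[:-x0, 1:]:] dvd d' \<and> [:[:-x0, 1:]:] dvd a')"
    proof
      assume "[:[:-x0, 1:]:] dvd d' \<and> [:[:-x0, 1:]:] dvd a'"
      then have "is_unit [:[:-x0, 1:]:]" using da(3) by (meson coprime_common_divisor)
      then show False by (simp add: is_unit_const_poly_iff is_unit_pCons_iff)
    qed
    then obtain g where g: "h dvd f g" "red g \<noteq> 0" using red0 h ha by blast
    define s where "s = map_poly (\<lambda>r. poly r x0) g"
    have s: "red g = map_poly (\<lambda>a. [:a:]) s"
      by (auto intro!: poly_eqI simp: red_def s_def coeff_map_poly)
    have "h dvd f (map_poly (\<lambda>a. [:a:]) s)" "s \<noteq> 0" using hred[OF g(1)] g(2) s by auto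
    moreover have "map_poly (\<lambda>a. [:a:]) (r * s) = map_poly (\<lambda>a. [:a:]) r * map_poly (\<lambda>a. [:a:]) s"
      for r s :: "complex poly"
      by (rule poly_eqI) (simp add: coeff_map_poly coeff_mult sum_to_poly mult.commute cong: sum.cong)
    ultimately obtain y0 where y0: "h dvd f (map_poly (\<lambda>a. [:a:]) [:-y0, 1:])"
      using prime_dvd_linear_factor[of "\<lambda>r. f (map_poly (\<lambda>a. [:a:]) r)" h s] h(2) f_const2
      by (auto simp: const2_def map_poly_pCons)
    have "[:[:-x0, 1:]:] = varX - const2 x0" "map_poly (\<lambda>a. [:a:]) [:-y0, 1:] = varY - const2 y0"
      by (simp_all add: varX_def varY_def const2_def map_poly_pCons one_pCons)
    then have "h dvd Jac (f varX) (f varY)"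
      using Jac_dvd_of_dvd_diff_const[of h "f varX" x0 "f varY" y0] x0 y0 by simp
    then have "is_unit h" using Jac is_unit_const2[OF c] by (metis dvd_trans)
    then show False using h(2) by (auto simp: prime_elem_def)
  qed
  then obtain b where b: "f d' = const2 b" "b \<noteq> 0"
    by (auto simp: is_unit_poly_iff const2_def dvd_field_iff)
  then have "f (d' - const2 b) = 0" by simp
  then have "d' = const2 b" by (simp del: f_diff)
  then have "is_unit d'" using is_unit_const2 b(2) by simp
  then show ?thesis unfolding da by (simp add: unit_imp_dvd)
qed (use assms in simp)

section \<open>The ring generated by the image and \<open>x\<close>\<close>

text \<open>
  Evaluation \<open>\<complex>[p,q][T] \<rightarrow> \<complex>[x,y]\<close> at \<open>T = x\<close>. Since \<open>f\<close> is injective, \<open>\<complex>[p,q]\<close> is replaced by its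
  isomorphic copy \<open>\<complex>[x,y]\<close>, and the coefficients are mapped by \<open>f\<close>.
\<close>

definition ev :: "cpoly2 poly \<Rightarrow> cpoly2" where
  "ev G = poly (map_poly f G) varX"

lemma ev_pCons [simp]: "ev (pCons a G) = f a + varX * ev G"
  by (simp add: ev_def map_poly_pCons)

lemma ev_0 [simp]: "ev 0 = 0"
  by (simp add: ev_def)

lemma ev_add [simp]: "ev (G + H) = ev G + ev H"
proof -
  have "map_poly f (G + H) = map_poly f G + map_poly f H"
    by (rule poly_eqI) (simp add: coeff_map_poly)
  then show ?thesis by (simp add: ev_def)
qed

lemma ev_smult [simp]: "ev (smult a G) = f a * ev G"
  by (induction G) (simp_all add: algebra_simps)

lemma ev_diff [simp]: "ev (G - H) = ev G - ev H"
  by (metis ev_add add_diff_cancel_right' diff_add_cancel)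

lemma ev_mult [simp]: "ev (G * H) = ev G * ev H"
  by (induction G) (simp_all add: algebra_simps)

text \<open>
  The generator is \<open>0\<close> when \<open>ev\<close> is injective; that case need not be excluded here.
\<close>

lemma ev_kernel_generator:
  obtains F where "ev F = 0" "\<And>G. ev G = 0 \<Longrightarrow> F dvd G"
proof (cases "\<exists>G\<in>{G. ev G = 0}. G \<noteq> 0")
  case True
  obtain m where m: "ev m = 0" "m \<noteq> 0" "\<And>G. ev G = 0 \<Longrightarrow> primitive_part m dvd G"
    using ideal_primitive_generator[OF _ _ True] by auto
  have "f (content m) * ev (primitive_part m) = ev m"
    by (simp flip: ev_smult)
  then have "ev (primitive_part m) = 0" using m by simp
  then show ?thesis using that m by blast
next
  case False
  then show ?thesis using that[of 0] by auto
qed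

text \<open>
  Let \<open>W = U/V\<close>, which takes the value \<open>y\<close> at \<open>T = x\<close>. The polynomial \<open>G\<close> represents
  \<open>V\<^sup>k g(T, W)\<close>, and the second equation is the chain rule
  \<open>G'(x) = V\<^sup>k (g\<^sub>x + g\<^sub>y W'(x))\<close> multiplied by \<open>V\<close>; here \<open>V\<close> is constant in \<open>T\<close>.
\<close>

lemma clear_denominators:
  assumes U: "ev U = f V * varY"
  shows "\<exists>k G. ev G = f V ^ k * g \<and>
    f V * ev (pderiv G) = f V ^ k * (f V * partial_x g + ev (pderiv U) * partial_y g)"
proof (induction g rule: cpoly2_induct)
  case (const a)
  show ?case by (rule exI[of _ 0], rule exI[of _ "[:const2 a:]"]) simp
next
  case varX
  show ?case by (rule exI[of _ 0], rule exI[of _ "[:0, 1:]"]) (simp add: pderiv_pCons)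
next
  case varY
  show ?case by (rule exI[of _ 1], rule exI[of _ U]) (simp add: U)
next
  case (add g h)
  then obtain k G l H where
    G: "ev G = f V ^ k * g" "f V * ev (pderiv G) = f V ^ k * (f V * partial_x g + ev (pderiv U) * partial_y g)" and
    H: "ev H = f V ^ l * h" "f V * ev (pderiv H) = f V ^ l * (f V * partial_x h + ev (pderiv U) * partial_y h)"
    by blast
  let ?K = "smult (V ^ l) G + smult (V ^ k) H"
  have "f V * ev (pderiv ?K) = f V ^ l * (f V * ev (pderiv G)) + f V ^ k * (f V * ev (pderiv H))"
    by (simp add: pderiv_add pderiv_smult algebra_simps)
  also have "\<dots> = f V ^ (k + l) * (f V * partial_x (g + h) + ev (pderiv U) * partial_y (g + h))"
    unfolding G H by (simp add: power_add algebra_simps)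
  finally show ?case
    by (intro exI[of _ "k + l"] exI[of _ ?K] conjI) (simp_all add: G H power_add algebra_simps)
next
  case (mult g h)
  then obtain k G l H where
    G: "ev G = f V ^ k * g" "f V * ev (pderiv G) = f V ^ k * (f V * partial_x g + ev (pderiv U) * partial_y g)" and
    H: "ev H = f V ^ l * h" "f V * ev (pderiv H) = f V ^ l * (f V * partial_x h + ev (pderiv U) * partial_y h)"
    by blast
  have "f V * ev (pderiv (G * H)) = (f V * ev (pderiv G)) * ev H + ev G * (f V * ev (pderiv H))"
    by (simp add: pderiv_mult algebra_simps)
  also have "\<dots> = f V ^ (k + l) * (f V * partial_x (g * h) + ev (pderiv U) * partial_y (g * h))"
    unfolding G H by (simp add: partial_x_mult partial_y_mult power_add algebra_simps)
  finally show ?case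
    by (intro exI[of _ "k + l"] exI[of _ "G * H"] conjI) (simp_all add: G H power_add algebra_simps)
qed

text \<open>
  This is where the Jacobian enters: the two relations \<open>p(T,W) = p\<close> and \<open>q(T,W) = q\<close>, valid at
  \<open>T = x\<close>, are differentiated with respect to \<open>T\<close>, and \<open>W'(x)\<close> is eliminated between them.
\<close>

lemma ev_pderiv_generator_dvd_power:
  assumes U: "ev U = f V * varY"
    and F: "ev F = 0" "\<And>G. ev G = 0 \<Longrightarrow> F dvd G"
  shows "\<exists>w n. ev (pderiv F) * w = f V ^ n"
proof -
  have rel: "\<exists>k a. f V * (ev (pderiv F) * a) =
      f V ^ k * (f V * partial_x (f g) + ev (pderiv U) * partial_y (f g))" for g
  proof -
    obtain k G where G: "ev G = f V ^ k * f g"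
      "f V * ev (pderiv G) = f V ^ k * (f V * partial_x (f g) + ev (pderiv U) * partial_y (f g))"
      using clear_denominators[OF U] by blast
    \<comment> \<open>Subtracting a constant of \<open>\<complex>[p,q]\<close> gives an element of the kernel with the same derivative.\<close>
    let ?H = "G - [:V ^ k * g:]"
    have "ev ?H = 0" by (simp add: G)
    then obtain A where A: "?H = F * A" using F(2) by (metis dvdE)
    have "pderiv G = pderiv ?H" by (simp add: pderiv_diff pderiv_pCons)
    then have "ev (pderiv G) = ev (pderiv F) * ev A"
      unfolding A by (simp add: pderiv_mult F)
    then show ?thesis using G(2) by metis
  qed
  obtain k a where a: "f V * (ev (pderiv F) * a) =
      f V ^ k * (f V * partial_x (f varX) + ev (pderiv U) * partial_y (f varX))"
    using rel by blast
  obtain l b where b: "f V * (ev (pderiv F) * b) =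
      f V ^ l * (f V * partial_x (f varY) + ev (pderiv U) * partial_y (f varY))"
    using rel by blast
  let ?w = "f V * (f V ^ l * partial_y (f varY) * a - f V ^ k * partial_y (f varX) * b) * const2 (1 / c)"
  have "ev (pderiv F) * ?w =
      (f V ^ l * partial_y (f varY) * (f V * (ev (pderiv F) * a))
        - f V ^ k * partial_y (f varX) * (f V * (ev (pderiv F) * b))) * const2 (1 / c)"
    by (simp add: algebra_simps)
  also have "\<dots> = f V ^ (k + l + 1) * Jac (f varX) (f varY) * const2 (1 / c)"
    unfolding a b Jac_def by (simp add: power_add algebra_simps)
  also have "\<dots> = f V ^ (k + l + 1)"
    using c by (simp add: Jac mult.assoc flip: const2_simps(5))
  finally show ?thesis by blast
qed

text \<open>
  The hypothesis \<open>units\<close> says that divisors of powers of \<open>v = f V\<close> lie in \<open>\<complex>(p,q)\<close>.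
\<close>

lemma varX_in_range:
  assumes U: "ev U = f V * varY" and V: "V \<noteq> 0"
    and units: "\<And>g w n. g * w = f V ^ n \<Longrightarrow> \<exists>a b. b \<noteq> 0 \<and> f b * g = f a"
  shows "varX \<in> range f"
proof -
  obtain F where F: "ev F = 0" "\<And>G. ev G = 0 \<Longrightarrow> F dvd G"
    using ev_kernel_generator by blast
  obtain w n where wn: "ev (pderiv F) * w = f V ^ n"
    using ev_pderiv_generator_dvd_power[OF U F] by blast
  \<comment> \<open>In particular \<open>F\<close> is not zero: \<open>x\<close> is algebraic over \<open>\<complex>(p,q)\<close>.\<close>
  then have "pderiv F \<noteq> 0" using V by auto
  then have deg: "degree F \<noteq> 0" by (simp add: pderiv_eq_0_iff)
  obtain a b where ab: "b \<noteq> 0" "f b * ev (pderiv F) = f a" using units[OF wn] by blast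
  \<comment> \<open>A relation for \<open>x\<close> of degree less than that of the generator \<open>F\<close> must be trivial.\<close>
  let ?G = "smult b (pderiv F) - [:a:]"
  have "F dvd ?G" by (rule F(2)) (simp add: ab)
  moreover have "degree ?G < degree F"
    using deg ab(1) degree_diff_le_max[of "smult b (pderiv F)" "[:a:]"] by (simp add: degree_pderiv)
  ultimately have "?G = 0" using dvd_imp_degree_le[of F ?G] by (metis not_le)
  then have "degree (smult b (pderiv F)) = 0" by simp
  then have "degree F = 1" using ab(1) deg by (simp add: degree_pderiv)
  then obtain e d where F_eq: "F = [:e, d:]" and "d \<noteq> 0"
  proof (cases F)
    case (pCons e G)
    then have "G \<noteq> 0" "degree G = 0" using \<open>degree F = 1\<close> by (auto split: if_splits)
    then obtain d where "G = [:d:]" using degree_eq_zeroE by blast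
    then show ?thesis using that pCons \<open>G \<noteq> 0\<close> by simp
  qed
  have eq: "f d * varX = f (- e)"
    using F(1) by (simp add: F_eq eq_neg_iff_add_eq_0 algebra_simps)
  then have "f d dvd f (- e)" by (metis dvd_triv_left)
  then obtain s where "- e = d * s" using dvd_reflect by (metis dvdE)
  then have "f d * varX = f d * f s" using eq by simp
  then show ?thesis using \<open>d \<noteq> 0\<close> by auto
qed

lemma is_subring_range_f: "is_subring (range f)"
  by (rule is_subring_range[of f 1]) simp_all

lemma is_subring_range_ev: "is_subring (range ev)"
  by (rule is_subring_range[of ev "[:1:]"]) (simp_all del: pCons_one)

lemma alg_gen_subset_range_f: "alg_gen {f varX, f varY} \<subseteq> range f"
  unfolding alg_gen_def
proof (rule hull_minimal)
  show "range const2 \<union> {f varX, f varY} \<subseteq> range f"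
    using f_const2 by (metis Un_least empty_subsetI image_subsetI insert_subset rangeI)
qed (rule is_subring_range_f)

lemma alg_gen_subset_range_ev: "alg_gen {f varX, f varY, varX} \<subseteq> range ev"
  unfolding alg_gen_def
proof (rule hull_minimal)
  have "f g = ev [:g:]" "varX = ev [:0, 1:]" for g by simp_all
  then show "range const2 \<union> {f varX, f varY, varX} \<subseteq> range ev"
    using f_const2 by (metis (no_types, lifting) Un_least image_subsetI insert_subset empty_subsetI rangeI)
qed (rule is_subring_range_ev)

lemma field_gen_subset_fractions:
  "field_gen {f varX, f varY} \<subseteq> {to_fract (f a) / to_fract (f b) | a b. b \<noteq> 0}" (is "_ \<subseteq> ?K")
  unfolding field_gen_def
proof (rule hull_minimal)
  have f_in: "to_fract (f g) \<in> ?K" for g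
    by (rule CollectI, rule exI[of _ g], rule exI[of _ 1]) simp
  then show "to_fract ` (range const2 \<union> {f varX, f varY}) \<subseteq> ?K"
    using f_in[of "const2 _"] f_in by auto
  show "is_subfield ?K"
    unfolding is_subfield_def is_subring_def
  proof (intro conjI ballI impI)
    show "1 \<in> ?K" using f_in[of 1] by simp
  next
    fix g h assume "g \<in> ?K" "h \<in> ?K"
    then obtain a b a' b' where g: "g = to_fract (f a) / to_fract (f b)" "b \<noteq> 0"
      and h: "h = to_fract (f a') / to_fract (f b')" "b' \<noteq> 0" by blast
    have "g - h = to_fract (f (a * b' - a' * b)) / to_fract (f (b * b'))"
      "g * h = to_fract (f (a * a')) / to_fract (f (b * b'))"
      unfolding g(1) h(1) using g(2) h(2) by (simp_all add: diff_frac_eq)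
    moreover have "b * b' \<noteq> 0" using g h by simp
    ultimately show "g - h \<in> ?K" "g * h \<in> ?K" by blast+
  next
    fix g assume "g \<in> ?K" "g \<noteq> 0"
    then obtain a b where g: "g = to_fract (f a) / to_fract (f b)" "b \<noteq> 0" by blast
    then have "a \<noteq> 0" using \<open>g \<noteq> 0\<close> by auto
    moreover have "inverse g = to_fract (f b) / to_fract (f a)" using g by simp
    ultimately show "inverse g \<in> ?K" by blast
  qed
qed

end


section \<open>The automorphism criterion\<close>

theorem theorem3p1:
  fixes f :: "cpoly2 \<Rightarrow> cpoly2" and p q u v :: cpoly2
  assumes "alg_endo f"
    and "p = f varX" and "q = f varY"
    and "\<exists>c. c \<noteq> 0 \<and> Jac p q = const2 c"
    and "u \<in> alg_gen {p, q, varX} - {0}"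
    and "v \<in> alg_gen {p, q} - {0}"
    and "to_fract varY = to_fract u / to_fract v"
    and "unit_group (adjoin_inverse (alg_gen {p, q, varX}) v) \<subseteq> field_gen {p, q} - {0}"
  shows "alg_auto f"
proof -
  obtain c where c: "c \<noteq> 0" "Jac p q = const2 c" using assms(4) by blast
  interpret keller_endo f c
    using assms(1-3) c by unfold_locales auto
  have v0: "v \<noteq> 0" using assms(6) by blast
  obtain U where U: "u = ev U" using assms(2,3,5) alg_gen_subset_range_ev by auto
  obtain V where V: "v = f V" using assms(2,3,6) alg_gen_subset_range_f by auto
  have "to_fract (v * varY) = to_fract u" using assms(7) v0 by simp
  then have vy: "v * varY = u" unfolding to_fract_eq_iff .
  have "varX \<in> range f"
  proof (rule varX_in_range)
    show "ev U = f V * varY" using vy U V by simp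
    show "V \<noteq> 0" using v0 V by auto
    fix g w n assume "g * w = f V ^ n"
    then have "to_fract g \<in> field_gen {p, q}"
      using adjoin_inverse_units[of "{p, q, varX}" u v g w n] assms(5,7,8) v0 V by auto
    then obtain a b where "to_fract g = to_fract (f a) / to_fract (f b)" "b \<noteq> 0"
      using field_gen_subset_fractions assms(2,3) by blast
    then have "to_fract (f b * g) = to_fract (f a)" by simp
    then show "\<exists>a b. b \<noteq> 0 \<and> f b * g = f a" using \<open>b \<noteq> 0\<close> unfolding to_fract_eq_iff by blast
  qed
  then obtain x' where x': "varX = f x'" by blast
  have ev_range: "ev G \<in> range f" for G
  proof (induction G)
    case (pCons a G)
    then obtain s where "ev G = f s" by blast
    then have "ev (pCons a G) = f (a + x' * s)" by (simp add: x')
    then show ?case by blast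
  qed (metis ev_0 f_0 rangeI)
  then obtain u' where u': "u = f u'" using U by blast
  have "f V dvd f u'" using vy V u' by (metis dvd_triv_left)
  then obtain y' where "u' = V * y'" using dvd_reflect by (metis dvdE)
  then have "v * varY = v * f y'" using vy u' V by simp
  then have y': "varY = f y'" using v0 by simp
  have "g \<in> range f" for g
  proof (induction g rule: cpoly2_induct)
    case (const a)
    show ?case by (metis f_const2 rangeI)
  qed (use x' y' in \<open>auto simp flip: f_add f_mult\<close>)
  then have "surj f" by blast
  then show ?thesis using assms(1) inj_f by (simp add: alg_auto_def bij_def)
qed

end
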